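(* Let $G$ be the incidence graph of a $\mathrm{BIBD}(v,b,r,k,1)$ with $r = k+1$ and $k \ge 3$. Then $\zeta(G) \le k+1$.
   Context: A $\mathrm{BIBD}(v,b,r,k,\lambda)$ is a set $X$ of $v$ points together with a collection $\mathcal{B}$ of $b$ blocks (subsets of $X$) such that every block has size $k$, every point lies in exactly $r$ blocks, and every pair of distinct points lies in exactly $\lambda$ blocks. Its incidence graph is the bipartite graph on $X \cup \mathcal{B}$ with $x \sim B$ iff $x \in B$. Localization game on a connected graph $G$ with $k$ cops: the robber chooses a starting vertex, invisible to the cops. Each round the cops choose any $k$ vertices (no adjacency restriction) and each learns its distance to the robber; the cops win if after finitely many rounds they determine the robber's vertex uniquely; otherwise the robber moves to a neighbour or stays. The robber knows the cops' strategy. $\zeta(G)$ is the least $k$ for which $k$ cops can guarantee capture. *)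

theory Defs
  imports "Graph_Theory.Pair_Digraph" "HOL-Library.Extended_Nat"
begin

text \<open>The blocks form a set rather than a multiset: for \<open>l = 1\<close> and \<open>k \<ge> 2\<close> no block
  can be repeated, since two of its points would lie in two blocks.\<close>

definition bibd ::
  "'a set \<Rightarrow> 'a set set \<Rightarrow> nat \<Rightarrow> nat \<Rightarrow> nat \<Rightarrow> nat \<Rightarrow> nat \<Rightarrow> bool" where
  "bibd X \<B> v b r k l \<longleftrightarrow>
     finite X \<and> card X = v \<and>
     finite \<B> \<and> card \<B> = b \<and>
     (\<forall>B\<in>\<B>. B \<subseteq> X \<and> card B = k) \<and>
     (\<forall>x\<in>X. card {B \<in> \<B>. x \<in> B} = r) \<and>
     (\<forall>x\<in>X. \<forall>y\<in>X. x \<noteq> y \<longrightarrow> card {B \<in> \<B>. x \<in> B \<and> y \<in> B} = l)"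

text \<open>Undirected graphs are represented by digraphs with a symmetric set of arcs.\<close>

definition incidence_graph :: "'a set \<Rightarrow> 'a set set \<Rightarrow> ('a + 'a set) pair_pre_digraph" where
  "incidence_graph X \<B> =
     \<lparr> pverts = Inl ` X \<union> Inr ` \<B>,
       parcs = {(Inl x, Inr B) | x B. x \<in> X \<and> B \<in> \<B> \<and> x \<in> B}
             \<union> {(Inr B, Inl x) | x B. x \<in> X \<and> B \<in> \<B> \<and> x \<in> B} \<rparr>"

lemma pair_graph_incidence_graph:
  assumes "finite X" and "finite \<B>"
  shows "pair_graph (incidence_graph X \<B>)"
proof
  let ?G = "incidence_graph X \<B>"
  show fst: "fst e \<in> pverts ?G" and snd: "snd e \<in> pverts ?G" if "e \<in> parcs ?G" for e
    using that by (auto simp: incidence_graph_def)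
  show fin: "finite (pverts ?G)"
    using assms by (simp add: incidence_graph_def)
  have "parcs ?G \<subseteq> pverts ?G \<times> pverts ?G"
    using fst snd by (auto simp: mem_Times_iff)
  then show "finite (parcs ?G)"
    using fin by (meson finite_SigmaI finite_subset)
  show "fst e \<noteq> snd e" if "e \<in> parcs ?G" for e
    using that by (auto simp: incidence_graph_def)
  show "symmetric (with_proj ?G)"
    by (auto simp: symmetric_def sym_def incidence_graph_def)
qed

definition graph_dist :: "'a pair_pre_digraph \<Rightarrow> 'a \<Rightarrow> 'a \<Rightarrow> enat" where
  "graph_dist G u w = (INF p \<in> {p. pre_digraph.awalk (with_proj G) u p w}. enat (length p))"

text \<open>\<open>w n\<close> is the robber's position when the cops probe in round \<open>n\<close>, counting from \<open>0\<close>.\<close>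

definition robber_walk :: "'a pair_pre_digraph \<Rightarrow> (nat \<Rightarrow> 'a) \<Rightarrow> bool" where
  "robber_walk G w \<longleftrightarrow>
     w 0 \<in> pverts G \<and> (\<forall>n. w (Suc n) = w n \<or> (w n, w (Suc n)) \<in> parcs G)"

text \<open>A strategy maps the answers of all previous rounds (one list of distances per round)
  to the vertices probed next. The earlier probes need not be recorded, as the strategy
  determines them from the answers.\<close>

type_synonym 'a cop_strategy = "enat list list \<Rightarrow> 'a list"

text \<open>The answers obtained in the first \<open>n\<close> rounds against the robber \<open>w\<close>.\<close>

primrec answers ::
  "'a pair_pre_digraph \<Rightarrow> 'a cop_strategy \<Rightarrow> (nat \<Rightarrow> 'a) \<Rightarrow> nat \<Rightarrow> enat list list" where
  "answers G \<sigma> w 0 = []"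
| "answers G \<sigma> w (Suc n) =
     answers G \<sigma> w n @ [map (\<lambda>c. graph_dist G c (w n)) (\<sigma> (answers G \<sigma> w n))]"

text \<open>The robber \<open>w\<close> is located in round \<open>n\<close> if every robber that has produced the same
  answers up to and including that round is now at the same vertex. Quantifying over all \<open>w\<close>
  accounts for a robber who knows the strategy.\<close>

definition winning_strategy :: "'a pair_pre_digraph \<Rightarrow> nat \<Rightarrow> 'a cop_strategy \<Rightarrow> bool" where
  "winning_strategy G m \<sigma> \<longleftrightarrow>
     (\<forall>h. length (\<sigma> h) = m \<and> set (\<sigma> h) \<subseteq> pverts G) \<and>
     (\<forall>w. robber_walk G w \<longrightarrow>
        (\<exists>n. \<forall>w'. robber_walk G w' \<and> answers G \<sigma> w' (Suc n) = answers G \<sigma> w (Suc n)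
                \<longrightarrow> w' n = w n))"

text \<open>The infimum is the least number of cops that suffices, or \<open>\<infinity>\<close> if no finite number does.\<close>

definition localization_number :: "'a pair_pre_digraph \<Rightarrow> enat" where
  "localization_number G = (INF m \<in> {m. \<exists>\<sigma>. winning_strategy G m \<sigma>}. enat m)"

end

theory Submission
  imports Defs
begin

text \<open>Counting shows that the design is an affine plane of order \<open>k\<close>: it has \<open>k + 1\<close> parallel
  classes of \<open>k\<close> lines each. Distances from a probed line reveal incidence with points and
  equality or parallelism with lines; distances from a probed point reveal equality and
  incidence. Probing all lines through one point confines the robber to \<open>k - 1\<close> points of a line,
  or to \<open>k - 1\<close> parallel lines; one further probe reduces the latter case to at most \<open>k - 2\<close>
  collinear points. From \<open>s\<close> candidate points on a line, the cops probe these points and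
  \<open>k + 1 - s\<close> further directions, which leaves \<open>s - 1\<close> candidate lines through a known point if
  the robber has moved to a line. From \<open>t\<close> concurrent candidate lines, they probe these lines and
  \<open>k + 1 - t\<close> lines of another parallel class missing the common point, which leaves at most \<open>t - 2\<close>
  candidate points on one of the lines. The number of candidates drops until one is left.\<close>

section \<open>Candidate sets and winning strategies\<close>

text \<open>The positions open to the robber after its next move, once the answers have confined it
  to \<open>R\<close>.\<close>

definition closed_nbhd :: "'a pair_pre_digraph \<Rightarrow> 'a set \<Rightarrow> 'a set" where
  "closed_nbhd G R = R \<union> {u. \<exists>r\<in>R. (r, u) \<in> parcs G}"

text \<open>\<open>P\<close> collects the possible positions at the moment of a probe. Since the
  predicate is inductive, every play ends after finitely many rounds. Enlarging an answer class to
  \<open>R\<close> discards information, so that the game can continue from a set of convenient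
  shape.\<close>

inductive cops_win :: "'a pair_pre_digraph \<Rightarrow> nat \<Rightarrow> 'a set \<Rightarrow> bool" for G m where
  probe: "length c = m \<Longrightarrow> set c \<subseteq> pverts G \<Longrightarrow>
    (\<And>u. u \<in> P \<Longrightarrow> \<exists>R. {u' \<in> P. \<forall>d\<in>set c. graph_dist G d u' = graph_dist G d u} \<subseteq> R \<and>
        (R = {u} \<or> cops_win G m (closed_nbhd G R))) \<Longrightarrow> cops_win G m P"

text \<open>Spare cops repeat a vertex of \<open>C\<close>, which is why \<open>C\<close> is
  nonempty; a repeated probe adds no information.\<close>

lemma cops_win_probe_set:
  assumes "finite C" "C \<noteq> {}" "card C \<le> m" "C \<subseteq> pverts G"
    and step: "\<And>u. u \<in> P \<Longrightarrow> \<exists>R. {u' \<in> P. \<forall>d\<in>C. graph_dist G d u' = graph_dist G d u} \<subseteq> R \<and>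
        (R = {u} \<or> cops_win G m (closed_nbhd G R))"
  shows "cops_win G m P"
proof -
  obtain cs where cs: "set cs = C" "distinct cs"
    using finite_distinct_list assms(1) by blast
  then have len: "length cs \<le> m" and "cs \<noteq> []"
    using assms(2,3) distinct_card by force+
  define c where "c = cs @ replicate (m - length cs) (hd cs)"
  have "set c = C" "length c = m"
    using cs len \<open>cs \<noteq> []\<close> by (auto simp: c_def)
  then show ?thesis
    using assms(4) step by (intro cops_win.probe[of c]) auto
qed

section \<open>From candidate sets to cop strategies\<close>

definition legal :: "'a pair_pre_digraph \<Rightarrow> nat \<Rightarrow> 'a cop_strategy \<Rightarrow> bool" where
  "legal G m \<sigma> \<longleftrightarrow> (\<forall>h. length (\<sigma> h) = m \<and> set (\<sigma> h) \<subseteq> pverts G)"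

text \<open>In contrast to \<open>robber_walk\<close>, the start ranges over an arbitrary set, so
  that the walk seen from the second round on is again of this kind.\<close>

definition walks_from :: "'a pair_pre_digraph \<Rightarrow> 'a set \<Rightarrow> (nat \<Rightarrow> 'a) set" where
  "walks_from G P = {w. w 0 \<in> P \<and> (\<forall>n. w (Suc n) = w n \<or> (w n, w (Suc n)) \<in> parcs G)}"

definition locates :: "'a pair_pre_digraph \<Rightarrow> 'a cop_strategy \<Rightarrow> (nat \<Rightarrow> 'a) set \<Rightarrow> bool" where
  "locates G \<sigma> W \<longleftrightarrow> (\<forall>w\<in>W. \<exists>n. \<forall>w'\<in>W.
     answers G \<sigma> w' (Suc n) = answers G \<sigma> w (Suc n) \<longrightarrow> w' n = w n)"

text \<open>\<open>answers\<close> grows at its end, whereas the induction over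
  \<open>cops_win\<close> peels off the first round. Here the history is read from the front, the
  first answer becoming part of the strategy.\<close>

lemma answers_unfold_first:
  "answers G \<sigma> w (Suc n) =
     (let a = map (\<lambda>c. graph_dist G c (w 0)) (\<sigma> [])
      in a # answers G (\<lambda>h. \<sigma> (a # h)) (\<lambda>i. w (Suc i)) n)"
  by (induction n) (simp_all add: Let_def)

lemma walks_from_shift:
  assumes "w \<in> walks_from G P" "w 0 \<in> R"
  shows "(\<lambda>i. w (Suc i)) \<in> walks_from G (closed_nbhd G R)"
proof -
  have step: "w (Suc n) = w n \<or> (w n, w (Suc n)) \<in> parcs G" for n
    using assms(1) by (simp add: walks_from_def)
  have "w (Suc 0) \<in> closed_nbhd G R"
    using step[of 0] assms(2) by (auto simp: closed_nbhd_def)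
  then show ?thesis using step by (simp add: walks_from_def)
qed

text \<open>The induction hypothesis supplies a continuation for every answer; the strategy probes
  \<open>c\<close> and then follows the continuation chosen for the answer received.\<close>

lemma cops_win_strategy:
  assumes "cops_win G m P"
  shows "\<exists>\<sigma>. legal G m \<sigma> \<and> locates G \<sigma> (walks_from G P)"
  using assms
proof induction
  case (probe c P)
  define resp where "resp u = map (\<lambda>d. graph_dist G d u) c" for u
  define Q where "Q a = {u \<in> P. resp u = a}" for a
  \<comment> \<open>An answer that no candidate produces has \<open>Q a = {}\<close>, so the first
    disjunct holds and only legality remains; thus a continuation exists for every
    \<open>a\<close>.\<close>
  define next_ok where "next_ok a \<sigma> \<longleftrightarrow> legal G m \<sigma> \<and>
      ((\<exists>u. Q a \<subseteq> {u}) \<or> (\<exists>R. Q a \<subseteq> R \<and> locates G \<sigma> (walks_from G (closed_nbhd G R))))" for a \<sigma>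
  have legal_c: "legal G m (\<lambda>_. c)"
    using probe.hyps by (simp add: legal_def)
  have "\<exists>\<sigma>. next_ok a \<sigma>" for a
  proof (cases "Q a = {}")
    case True
    then show ?thesis using legal_c unfolding next_ok_def by blast
  next
    case False
    then obtain u where u: "u \<in> P" "resp u = a" by (auto simp: Q_def)
    have "Q a = {u' \<in> P. \<forall>d\<in>set c. graph_dist G d u' = graph_dist G d u}"
      using u(2) by (auto simp: Q_def resp_def)
    then obtain R where R: "Q a \<subseteq> R"
      "R = {u} \<or> (\<exists>\<sigma>. legal G m \<sigma> \<and> locates G \<sigma> (walks_from G (closed_nbhd G R)))"
      using probe.IH[OF u(1)] by auto
    from R(2) show ?thesis
    proof
      assume "R = {u}"
      then show ?thesis using R(1) legal_c unfolding next_ok_def by blast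
    next
      assume "\<exists>\<sigma>. legal G m \<sigma> \<and> locates G \<sigma> (walks_from G (closed_nbhd G R))"
      then show ?thesis using R(1) unfolding next_ok_def by blast
    qed
  qed
  then obtain \<tau> where \<tau>: "next_ok a (\<tau> a)" for a by metis
  define \<sigma> where "\<sigma> h = (case h of [] \<Rightarrow> c | a # h' \<Rightarrow> \<tau> a h')" for h
  have ans: "answers G \<sigma> w (Suc n) =
      resp (w 0) # answers G (\<tau> (resp (w 0))) (\<lambda>i. w (Suc i)) n" for w n
    unfolding answers_unfold_first by (simp add: Let_def \<sigma>_def resp_def)
  have "\<exists>n. \<forall>w'\<in>walks_from G P.
      answers G \<sigma> w' (Suc n) = answers G \<sigma> w (Suc n) \<longrightarrow> w' n = w n"
    if w: "w \<in> walks_from G P" for w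
  proof -
    let ?a = "resp (w 0)"
    have w0: "w 0 \<in> Q ?a" using w by (simp add: Q_def walks_from_def)
    have same: "w' 0 \<in> Q ?a" 
      if "w' \<in> walks_from G P" "answers G \<sigma> w' (Suc n) = answers G \<sigma> w (Suc n)" for w' n
      using that unfolding ans by (simp add: Q_def walks_from_def)
    consider (caught) u where "Q ?a \<subseteq> {u}" 
      | (rec) R where "Q ?a \<subseteq> R" "locates G (\<tau> ?a) (walks_from G (closed_nbhd G R))"
      using \<tau>[of ?a] unfolding next_ok_def by blast
    then show ?thesis
    proof cases
      case caught
      \<comment> \<open>The first answer decides already, so the witness is round 0.\<close>
      then show ?thesis using same w0 by blast
    next
      case rec
      have shift: "(\<lambda>i. w' (Suc i)) \<in> walks_from G (closed_nbhd G R)"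
        if "w' \<in> walks_from G P" "w' 0 \<in> Q ?a" for w'
        using walks_from_shift[of w' G P R] that rec(1) by blast
      obtain n where n: "\<And>v. v \<in> walks_from G (closed_nbhd G R) \<Longrightarrow>
          answers G (\<tau> ?a) v (Suc n) = answers G (\<tau> ?a) (\<lambda>i. w (Suc i)) (Suc n) \<Longrightarrow>
          v n = w (Suc n)"
        using rec(2) shift[OF w w0] unfolding locates_def by blast
      \<comment> \<open>Round \<open>n\<close> of the continuation is round \<open>Suc n\<close> of
        the whole game.\<close>
      have "w' (Suc n) = w (Suc n)" 
        if w': "w' \<in> walks_from G P"
          and eq: "answers G \<sigma> w' (Suc (Suc n)) = answers G \<sigma> w (Suc (Suc n))" for w'
      proof -
        have "resp (w' 0) = ?a"
          using eq unfolding ans by (metis list.inject)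
        then show ?thesis
          using n[OF shift[OF w' same[OF w' eq]]] eq unfolding ans[of _ "Suc n"] by (metis list.inject)
      qed
      then show ?thesis by blast
    qed
  qed
  then have "locates G \<sigma> (walks_from G P)" by (simp add: locates_def)
  moreover have "legal G m \<sigma>"
    using probe.hyps \<tau> by (auto simp: legal_def \<sigma>_def next_ok_def split: list.split)
  ultimately show ?case by blast
qed

lemma localization_number_le:
  assumes "cops_win G m (pverts G)"
  shows "localization_number G \<le> enat m"
proof -
  obtain \<sigma> where "legal G m \<sigma>" "locates G \<sigma> (walks_from G (pverts G))"
    using cops_win_strategy[OF assms] by blast
  moreover have "walks_from G (pverts G) = {w. robber_walk G w}"
    by (auto simp: walks_from_def robber_walk_def)
  ultimately have "winning_strategy G m \<sigma>"
    unfolding winning_strategy_def legal_def locates_def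
    by (simp del: answers.simps add: imp_conjL)
  then show ?thesis
    unfolding localization_number_def by (intro INF_lower) auto
qed

lemma graph_dist_eqI:
  assumes "pre_digraph.awalk (with_proj H) u p w"
    and "\<And>q. pre_digraph.awalk (with_proj H) u q w \<Longrightarrow> length p \<le> length q"
  shows "graph_dist H u w = enat (length p)"
  unfolding graph_dist_def using assms by (intro antisym INF_lower INF_greatest) auto

section \<open>Affine planes\<close>

text \<open>The count of \<open>k + 1\<close> lines of size \<open>k\<close> through every point
  takes the place of the parallel axiom, which is derived from it in
  \<open>ex1_parallel\<close>.\<close>

locale affine_plane =
  fixes X :: "'a set" and \<B> :: "'a set set" and k :: nat
  assumes finite_points: "finite X"
    and finite_blocks: "finite \<B>"
    and block_subset: "B \<in> \<B> \<Longrightarrow> B \<subseteq> X"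
    and card_block: "B \<in> \<B> \<Longrightarrow> card B = k"
    and card_pencil: "x \<in> X \<Longrightarrow> card {B \<in> \<B>. x \<in> B} = k + 1"
    and card_join: "x \<in> X \<Longrightarrow> y \<in> X \<Longrightarrow> x \<noteq> y \<Longrightarrow> card {B \<in> \<B>. x \<in> B \<and> y \<in> B} = 1"
    and k_ge: "k \<ge> 2"
begin

definition pencil :: "'a \<Rightarrow> 'a set set" where
  "pencil x = {B \<in> \<B>. x \<in> B}"

text \<open>Equality is included to make this an equivalence relation on the lines.\<close>

definition parallel :: "'a set \<Rightarrow> 'a set \<Rightarrow> bool" where
  "parallel l m \<longleftrightarrow> l = m \<or> l \<inter> m = {}"

definition parallel_class :: "'a set \<Rightarrow> 'a set set" where
  "parallel_class l = {m \<in> \<B>. parallel l m}"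

lemma finite_block: "B \<in> \<B> \<Longrightarrow> finite B"
  using block_subset finite_points finite_subset by blast

lemma block_nonempty: "B \<in> \<B> \<Longrightarrow> B \<noteq> {}"
  using card_block k_ge by fastforce

lemma finite_pencil: "finite (pencil x)"
  using finite_blocks by (simp add: pencil_def)

lemma finite_parallel_class: "finite (parallel_class l)"
  using finite_blocks by (simp add: parallel_class_def)

lemma ex_join: "x \<in> X \<Longrightarrow> y \<in> X \<Longrightarrow> \<exists>B\<in>\<B>. x \<in> B \<and> y \<in> B"
proof (cases "x = y")
  case True
  assume "x \<in> X"
  then have "{B \<in> \<B>. x \<in> B} \<noteq> {}"
    using card_pencil[of x] by (metis Suc_eq_plus1 card.empty nat.distinct(1))
  then show ?thesis using True by blast
next
  case False
  assume "x \<in> X" "y \<in> X"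
  then have "{B \<in> \<B>. x \<in> B \<and> y \<in> B} \<noteq> {}" using card_join[of x y] False by (metis card.empty zero_neq_one)
  then show ?thesis by blast
qed

lemma join_unique:
  assumes "l \<in> \<B>" "m \<in> \<B>" "x \<in> l" "y \<in> l" "x \<in> m" "y \<in> m" "x \<noteq> y"
  shows "l = m"
proof -
  have "card {B \<in> \<B>. x \<in> B \<and> y \<in> B} = 1"
    using assms block_subset card_join by blast
  then obtain B where "{B \<in> \<B>. x \<in> B \<and> y \<in> B} = {B}" by (auto simp: card_1_singleton_iff)
  moreover have "l \<in> {B \<in> \<B>. x \<in> B \<and> y \<in> B}" "m \<in> {B \<in> \<B>. x \<in> B \<and> y \<in> B}"
    using assms by simp_all
  ultimately show ?thesis by simp
qed

lemma parallel_refl [simp]: "parallel l l"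
  by (simp add: parallel_def)

lemma meet_unique:
  assumes "l \<in> \<B>" "m \<in> \<B>" "\<not> parallel l m" "x \<in> l" "x \<in> m" "y \<in> l" "y \<in> m"
  shows "x = y"
  using assms join_unique parallel_refl by metis

lemma parallel_sym: "parallel l m \<longleftrightarrow> parallel m l"
  by (auto simp: parallel_def)

lemma parallel_eqI: "parallel l m \<Longrightarrow> x \<in> l \<Longrightarrow> x \<in> m \<Longrightarrow> l = m"
  by (auto simp: parallel_def)

text \<open>A point off \<open>l\<close> is joined to the \<open>k\<close> points of \<open>l\<close> by \<open>k\<close> different lines, so exactly one
  of the \<open>k + 1\<close> lines through it misses \<open>l\<close>.\<close>

lemma ex1_parallel:
  assumes "l \<in> \<B>" "x \<in> X"
  shows "\<exists>!m. m \<in> \<B> \<and> x \<in> m \<and> parallel l m"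
proof (cases "x \<in> l")
  case True
  then show ?thesis using assms by (auto simp: parallel_def)
next
  case False
  define j where "j y = (SOME m. m \<in> \<B> \<and> x \<in> m \<and> y \<in> m)" for y
  have j: "j y \<in> \<B> \<and> x \<in> j y \<and> y \<in> j y" if "y \<in> l" for y
    unfolding j_def by (rule someI_ex) (use that assms ex_join block_subset in blast)
  have "inj_on j l"
  proof (rule inj_onI)
    fix y z assume yz: "y \<in> l" "z \<in> l" "j y = j z"
    show "y = z"
    proof (rule ccontr)
      assume "y \<noteq> z"
      then have "j y = l" using join_unique[of "j y" l y z] j yz assms by metis
      then show False using j yz(1) False by blast
    qed
  qed
  then have "card (j ` l) = k" using card_image card_block assms by metis
  moreover have "j ` l \<subseteq> pencil x" using j by (auto simp: pencil_def)
  ultimately have "card (pencil x - j ` l) = 1"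
    using card_pencil[OF assms(2)] by (simp add: card_Diff_subset finite_block assms pencil_def)
  then obtain n where n: "pencil x - j ` l = {n}" by (auto simp: card_1_singleton_iff)
  have iff: "m \<in> j ` l \<longleftrightarrow> \<not> parallel l m" if "m \<in> pencil x" for m
  proof
    assume "m \<in> j ` l"
    then show "\<not> parallel l m" using j False by (auto simp: parallel_def)
  next
    assume "\<not> parallel l m"
    then obtain y where y: "y \<in> l" "y \<in> m" by (auto simp: parallel_def)
    then have "m = j y"
      using join_unique[of m "j y" x y] j[OF y(1)] that False by (auto simp: pencil_def)
    then show "m \<in> j ` l" using y by blast
  qed
  show ?thesis
  proof (rule ex1I[of _ n])
    have "n \<in> pencil x" "n \<notin> j ` l" using n by blast+
    then show "n \<in> \<B> \<and> x \<in> n \<and> parallel l n" using iff by (simp add: pencil_def)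
    show "m = n" if "m \<in> \<B> \<and> x \<in> m \<and> parallel l m" for m
    proof -
      have "m \<in> pencil x - j ` l" using that iff[of m] by (simp add: pencil_def)
      then show ?thesis using n by blast
    qed
  qed
qed

text \<open>If \<open>l\<close> and \<open>n\<close> met in a point, both would be the unique line
  through that point parallel to \<open>m\<close>.\<close>

lemma parallel_trans:
  assumes "l \<in> \<B>" "m \<in> \<B>" "n \<in> \<B>" "parallel l m" "parallel m n"
  shows "parallel l n"
proof (rule ccontr)
  assume np: "\<not> parallel l n"
  then obtain x where x: "x \<in> l" "x \<in> n" by (auto simp: parallel_def)
  then have "l = n"
    using ex1_parallel[OF assms(2), of x] assms block_subset parallel_sym by blast
  then show False using np by simp
qed

section \<open>Counting with transversals and directions\<close>

lemma ex_nonparallel: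
  assumes "l \<in> \<B>"
  shows "\<exists>n\<in>\<B>. \<not> parallel l n"
proof -
  obtain x where x: "x \<in> l" "x \<in> X" using block_nonempty block_subset assms by blast
  have "\<not> pencil x \<subseteq> {l}"
    using card_pencil[OF x(2)] card_mono[of "{l}" "pencil x"] k_ge by (auto simp: pencil_def)
  then obtain n where n: "n \<in> \<B>" "x \<in> n" "n \<noteq> l" by (auto simp: pencil_def)
  then show ?thesis using x parallel_eqI by metis
qed

text \<open>A line \<open>n\<close> not parallel to \<open>l\<close> meets every line of the class
  in exactly one point, and every point of \<open>n\<close> lies on exactly one line of the class;
  so the class has as many lines as \<open>n\<close> has points.\<close>

lemma card_parallel_class:
  assumes "l \<in> \<B>"
  shows "card (parallel_class l) = k"
proof -
  obtain n where n: "n \<in> \<B>" and np: "\<not> parallel l n" using ex_nonparallel[OF assms] by blast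
  define f where "f y = (THE m. m \<in> \<B> \<and> y \<in> m \<and> parallel l m)" for y
  have f: "f y \<in> \<B> \<and> y \<in> f y \<and> parallel l (f y)" if "y \<in> n" for y
    unfolding f_def by (rule theI') (use ex1_parallel assms block_subset n that in blast)
  have fnp: "\<not> parallel m n" if "m \<in> parallel_class l" for m
    using that np parallel_trans[of l m n] assms n by (auto simp: parallel_class_def)
  have "bij_betw f n (parallel_class l)"
    unfolding bij_betw_def
  proof
    show "inj_on f n"
    proof (rule inj_onI)
      fix y z assume "y \<in> n" "z \<in> n" "f y = f z"
      then show "y = z"
        using f[of y] f[of z] fnp[of "f y"] meet_unique[of "f y" n y z] n
        by (auto simp: parallel_class_def)
    qed
    show "f ` n = parallel_class l"
    proof
      show "f ` n \<subseteq> parallel_class l" using f by (auto simp: parallel_class_def)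
      show "parallel_class l \<subseteq> f ` n"
      proof
        fix m assume m: "m \<in> parallel_class l"
        then obtain y where y: "y \<in> m" "y \<in> n" using fnp by (auto simp: parallel_def)
        have "m = f y"
          using ex1_parallel[OF assms, of y] f[OF y(2)] m y n block_subset
          by (auto simp: parallel_class_def)
        then show "m \<in> f ` n" using y by blast
      qed
    qed
  qed
  then show ?thesis using card_block n bij_betw_same_card by metis
qed

text \<open>Each line of \<open>N\<close> cuts \<open>m\<close> in exactly one point, and distinct
  parallel lines cut it in distinct points.\<close>

lemma card_line_minus_class:
  assumes "m \<in> \<B>" "N \<subseteq> \<B>" "\<And>n. n \<in> N \<Longrightarrow> \<not> parallel m n"
    and "\<And>n n'. n \<in> N \<Longrightarrow> n' \<in> N \<Longrightarrow> parallel n n'"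
  shows "card (m - \<Union>N) = k - card N"
proof -
  have "\<exists>x. x \<in> m \<and> x \<in> n" if "n \<in> N" for n
    using assms(3)[OF that] by (auto simp: parallel_def)
  then obtain p where p: "p n \<in> m" "p n \<in> n" if "n \<in> N" for n by metis
  have "inj_on p N"
    by (rule inj_onI) (metis p assms(4) parallel_eqI)
  moreover have "m \<inter> \<Union>N = p ` N"
    using p assms meet_unique by blast
  ultimately have "card (m \<inter> \<Union>N) = card N" by (simp add: card_image)
  then show ?thesis
    using card_block[OF assms(1)] finite_block[OF assms(1)]
    by (metis card_Diff_subset_Int finite_Int)
qed

text \<open>Sending a line through \<open>q\<close> to its parallel through \<open>z\<close> is
  injective, since parallel lines through \<open>q\<close> coincide. Hence lines of one pencil stand
  for distinct directions, which can be counted at any other point.\<close>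

lemma card_pencil_parallel:
  assumes "q \<in> X" "z \<in> X" "N \<subseteq> pencil q"
  shows "card {m \<in> pencil z. \<exists>n\<in>N. parallel n m} = card N"
proof -
  define f where "f n = (THE m. m \<in> \<B> \<and> z \<in> m \<and> parallel n m)" for n
  have f: "f n \<in> \<B> \<and> z \<in> f n \<and> parallel n (f n)" if "n \<in> N" for n
    unfolding f_def by (rule theI') (use ex1_parallel[of n z] assms(2,3) that in \<open>auto simp: pencil_def\<close>)
  have "inj_on f N"
  proof (rule inj_onI)
    fix n n' assume nn: "n \<in> N" "n' \<in> N" "f n = f n'"
    then have B: "n \<in> \<B>" "n' \<in> \<B>" "q \<in> n" "q \<in> n'" using assms(3) by (auto simp: pencil_def)
    then have "parallel n n'"
      using parallel_trans[of n "f n" n'] f[OF nn(1)] f[OF nn(2)] nn(3) parallel_sym by auto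
    then show "n = n'" using B parallel_eqI by metis
  qed
  moreover have "{m \<in> pencil z. \<exists>n\<in>N. parallel n m} = f ` N"
  proof (intro equalityI subsetI)
    fix m assume "m \<in> {m \<in> pencil z. \<exists>n\<in>N. parallel n m}"
    then obtain n where n: "n \<in> N" "parallel n m" "m \<in> \<B>" "z \<in> m" by (auto simp: pencil_def)
    then have "m = f n"
      using ex1_parallel[of n z] f[OF n(1)] assms by (auto simp: pencil_def)
    then show "m \<in> f ` N" using n by blast
  next
    fix m assume "m \<in> f ` N"
    then show "m \<in> {m \<in> pencil z. \<exists>n\<in>N. parallel n m}" using f by (auto simp: pencil_def)
  qed
  ultimately show ?thesis by (simp add: card_image)
qed

section \<open>Distances in the incidence graph\<close>

abbreviation G :: "('a + 'a set) pair_pre_digraph" where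
  "G \<equiv> incidence_graph X \<B>"

lemma arc_simps [simp]:
  "(Inl x, Inr B) \<in> parcs G \<longleftrightarrow> x \<in> X \<and> B \<in> \<B> \<and> x \<in> B"
  "(Inr B, Inl x) \<in> parcs G \<longleftrightarrow> x \<in> X \<and> B \<in> \<B> \<and> x \<in> B"
  "(Inl x, Inl y) \<notin> parcs G"
  "(Inr B, Inr B') \<notin> parcs G"
  by (auto simp: incidence_graph_def)

lemma vert_simps [simp]:
  "Inl x \<in> pverts G \<longleftrightarrow> x \<in> X"
  "Inr B \<in> pverts G \<longleftrightarrow> B \<in> \<B>"
  by (auto simp: incidence_graph_def)

lemma awalk_simps:
  "pre_digraph.awalk (with_proj G) u [] w \<longleftrightarrow> u = w \<and> u \<in> pverts G"
  "pre_digraph.awalk (with_proj G) u (e # es) w \<longleftrightarrow>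
     e \<in> parcs G \<and> u = fst e \<and> pre_digraph.awalk (with_proj G) (snd e) es w"
  by (auto simp: pre_digraph.awalk_def pre_digraph.cas.simps incidence_graph_def)

text \<open>The graph is bipartite: every arc changes sides.\<close>

lemma awalk_parity:
  "pre_digraph.awalk (with_proj G) u p w \<Longrightarrow> even (length p) \<longleftrightarrow> isl u = isl w"
proof (induction p arbitrary: u)
  case Nil
  then show ?case by (simp add: awalk_simps)
next
  case (Cons e p)
  then have e: "e \<in> parcs G" "u = fst e" "pre_digraph.awalk (with_proj G) (snd e) p w"
    by (auto simp: awalk_simps)
  then have "isl (snd e) \<noteq> isl u" by (auto simp: incidence_graph_def)
  then show ?case using Cons.IH[OF e(3)] by auto
qed

lemma dist_point_point:
  assumes "x \<in> X" "y \<in> X"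
  shows "graph_dist G (Inl x) (Inl y) = enat (if x = y then 0 else 2)"
proof (cases "x = y")
  case True
  then show ?thesis
    using graph_dist_eqI[of G "Inl x" "[]" "Inl y"] assms by (simp add: awalk_simps)
next
  case False
  obtain B where "B \<in> \<B>" "x \<in> B" "y \<in> B" using ex_join assms by blast
  then have "pre_digraph.awalk (with_proj G) (Inl x) [(Inl x, Inr B), (Inr B, Inl y)] (Inl y)"
    using assms by (simp add: awalk_simps)
  moreover have "2 \<le> length q"
    if q: "pre_digraph.awalk (with_proj G) (Inl x) q (Inl y)" for q
  proof -
    have "q \<noteq> []" using q False by (auto simp: awalk_simps)
    moreover have "even (length q)" using awalk_parity[OF q] by simp
    \<comment> \<open>\<open>remdups_adj.cases\<close> serves as a split into lists of length 0, 1
      and at least 2.\<close>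
    ultimately show ?thesis by (cases q rule: remdups_adj.cases) auto
  qed
  ultimately show ?thesis using graph_dist_eqI False by fastforce
qed

lemma awalk_incident_or_long:
  assumes q: "pre_digraph.awalk (with_proj G) u q w" and "isl u \<noteq> isl w"
  shows "(u, w) \<in> parcs G \<or> 3 \<le> length q"
proof -
  have odd: "odd (length q)" using awalk_parity[OF q] assms(2) by simp
  show ?thesis
  proof (cases "length q = 1")
    case True
    then obtain e where "q = [e]" by (auto simp: length_Suc_conv)
    then show ?thesis using q by (auto simp: awalk_simps)
  next
    case False
    moreover obtain i where "length q = 2 * i + 1" using odd by (elim oddE)
    ultimately show ?thesis by simp
  qed
qed

lemma dist_incidence:
  assumes "x \<in> X" "B \<in> \<B>"
  shows "graph_dist G (Inl x) (Inr B) = enat (if x \<in> B then 1 else 3)"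
    and "graph_dist G (Inr B) (Inl x) = enat (if x \<in> B then 1 else 3)"
proof -
  \<comment> \<open>If \<open>x\<close> is not on \<open>B\<close>, the line joining
    \<open>x\<close> to any point \<open>y\<close> of \<open>B\<close> gives a path of length
    3.\<close>
  obtain y where y: "y \<in> B" "y \<in> X" using block_nonempty block_subset assms by blast
  obtain l where l: "l \<in> \<B>" "x \<in> l" "y \<in> l" using ex_join assms y by blast
  have ne: "q \<noteq> []" if "pre_digraph.awalk (with_proj G) u q w" "isl u \<noteq> isl w" for u q w
    using that by (auto simp: awalk_simps)
  show "graph_dist G (Inl x) (Inr B) = enat (if x \<in> B then 1 else 3)"
  proof (cases "x \<in> B")
    case True
    then show ?thesis
      using graph_dist_eqI[of G "Inl x" "[(Inl x, Inr B)]" "Inr B"] assms ne[of "Inl x" _ "Inr B"]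
      by (simp add: awalk_simps Suc_le_eq)
  next
    case False
    then show ?thesis
      using graph_dist_eqI[of G "Inl x" "[(Inl x, Inr l), (Inr l, Inl y), (Inl y, Inr B)]" "Inr B"]
        assms l y awalk_incident_or_long[of "Inl x" _ "Inr B"]
      by (simp add: awalk_simps numeral_3_eq_3)
  qed
  show "graph_dist G (Inr B) (Inl x) = enat (if x \<in> B then 1 else 3)"
  proof (cases "x \<in> B")
    case True
    then show ?thesis
      using graph_dist_eqI[of G "Inr B" "[(Inr B, Inl x)]" "Inl x"] assms ne[of "Inr B" _ "Inl x"]
      by (simp add: awalk_simps Suc_le_eq)
  next
    case False
    then show ?thesis
      using graph_dist_eqI[of G "Inr B" "[(Inr B, Inl y), (Inl y, Inr l), (Inr l, Inl x)]" "Inl x"]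
        assms l y awalk_incident_or_long[of "Inr B" _ "Inl x"]
      by (simp add: awalk_simps numeral_3_eq_3)
  qed
qed

text \<open>Two lines have a common neighbour exactly when they meet. For distinct parallel lines, a
  line joining a point of one to a point of the other gives a path of length 4, the next even
  length.\<close>

lemma dist_block_block:
  assumes "l \<in> \<B>" "m \<in> \<B>"
  shows "graph_dist G (Inr l) (Inr m) = enat (if l = m then 0 else if parallel l m then 4 else 2)"
proof (cases "l = m")
  case True
  then show ?thesis
    using graph_dist_eqI[of G "Inr l" "[]" "Inr m"] assms by (simp add: awalk_simps)
next
  case neq: False
  have two: "2 \<le> length q" 
    if q: "pre_digraph.awalk (with_proj G) (Inr l) q (Inr m)" for q
  proof -
    have "q \<noteq> []" using q neq by (auto simp: awalk_simps)
    moreover have "even (length q)" using awalk_parity[OF q] by simp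
    ultimately show ?thesis by (cases q rule: remdups_adj.cases) auto
  qed
  show ?thesis
  proof (cases "parallel l m")
    case False
    then obtain x where x: "x \<in> l" "x \<in> m" by (auto simp: parallel_def)
    then have "pre_digraph.awalk (with_proj G) (Inr l) [(Inr l, Inl x), (Inl x, Inr m)] (Inr m)"
      using assms block_subset by (auto simp: awalk_simps)
    from graph_dist_eqI[OF this] show ?thesis using two neq False by (simp add: numeral_2_eq_2)
  next
    case True
    obtain x where x: "x \<in> l" "x \<in> X"
      using block_nonempty[OF assms(1)] block_subset[OF assms(1)] by blast
    obtain y where y: "y \<in> m" "y \<in> X"
      using block_nonempty[OF assms(2)] block_subset[OF assms(2)] by blast
    obtain n where n: "n \<in> \<B>" "x \<in> n" "y \<in> n" using ex_join x y by blast
    have four: "4 \<le> length q" if q: "pre_digraph.awalk (with_proj G) (Inr l) q (Inr m)" for q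
    proof (rule ccontr)
      assume "\<not> 4 \<le> length q"
      moreover have "even (length q)" using awalk_parity[OF q] by simp
      ultimately have "length q = 2" using two[OF q] by presburger
      then obtain e e' where "q = [e, e']" by (auto simp: numeral_2_eq_2 length_Suc_conv)
      then have "e \<in> parcs G" "fst e = Inr l" "e' \<in> parcs G" "fst e' = snd e" "snd e' = Inr m"
        using q by (auto simp: awalk_simps)
      then have "l \<inter> m \<noteq> {}" by (auto simp: incidence_graph_def)
      then show False using True neq by (simp add: parallel_def)
    qed
    have "pre_digraph.awalk (with_proj G) (Inr l)
        [(Inr l, Inl x), (Inl x, Inr n), (Inr n, Inl y), (Inl y, Inr m)] (Inr m)"
      using x y n assms by (simp add: awalk_simps)
    from graph_dist_eqI[OF this] show ?thesis
      using four True neq by (simp add: eval_nat_numeral)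
  qed
qed

section \<open>The cops' strategy\<close>

text \<open>By parity, every probe reveals whether the robber is on a point or on a block, so
  the candidate points and the candidate blocks can be treated separately.\<close>

lemma cops_win_probe:
  assumes "D \<subseteq> X" "N \<subseteq> \<B>" "D \<noteq> {} \<or> N \<noteq> {}" "card D + card N \<le> k + 1"
    and "S \<subseteq> X" "L \<subseteq> \<B>"
    and points: "\<And>y. y \<in> S \<Longrightarrow> \<exists>R.
      {y' \<in> S. (\<forall>d\<in>D. y' = d \<longleftrightarrow> y = d) \<and> (\<forall>n\<in>N. y' \<in> n \<longleftrightarrow> y \<in> n)} \<subseteq> R \<and>
      (R = {y} \<or> cops_win G (k + 1) (closed_nbhd G (Inl ` R)))"
    and blocks: "\<And>m. m \<in> L \<Longrightarrow> \<exists>R.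
      {m' \<in> L. (\<forall>d\<in>D. d \<in> m' \<longleftrightarrow> d \<in> m) \<and>
        (\<forall>n\<in>N. (m' = n \<longleftrightarrow> m = n) \<and> (parallel n m' \<longleftrightarrow> parallel n m))} \<subseteq> R \<and>
      (R = {m} \<or> cops_win G (k + 1) (closed_nbhd G (Inr ` R)))"
  shows "cops_win G (k + 1) (Inl ` S \<union> Inr ` L)"
proof (rule cops_win_probe_set[of "Inl ` D \<union> Inr ` N"])
  have fin: "finite D" "finite N"
    using assms(1,2) finite_points finite_blocks finite_subset by auto
  then show "finite (Inl ` D \<union> Inr ` N)" by simp
  show "Inl ` D \<union> Inr ` N \<noteq> {}" using assms(3) by auto
  show "card (Inl ` D \<union> Inr ` N) \<le> k + 1"
    using assms(4) fin by (subst card_Un_disjoint) (auto simp: card_image)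
  show "Inl ` D \<union> Inr ` N \<subseteq> pverts G" using assms(1,2) by auto
next
  fix u assume u: "u \<in> Inl ` S \<union> Inr ` L"
  let ?same = "\<lambda>u'. \<forall>d\<in>Inl ` D \<union> Inr ` N. graph_dist G d u' = graph_dist G d u"
  show "\<exists>R. {u' \<in> Inl ` S \<union> Inr ` L. ?same u'} \<subseteq> R \<and>
      (R = {u} \<or> cops_win G (k + 1) (closed_nbhd G R))"
  proof (cases u)
    case (Inl y)
    then have y: "y \<in> S" using u by auto
    obtain R where R: "{y' \<in> S. (\<forall>d\<in>D. y' = d \<longleftrightarrow> y = d) \<and> (\<forall>n\<in>N. y' \<in> n \<longleftrightarrow> y \<in> n)} \<subseteq> R"
      "R = {y} \<or> cops_win G (k + 1) (closed_nbhd G (Inl ` R))"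
      using points[OF y] by blast
    have "u' \<in> Inl ` R" if "u' \<in> Inl ` S \<union> Inr ` L" and same: "?same u'" for u'
    proof (cases u')
      case (Inl y')
      then have y': "y' \<in> S" using that by auto
      have "y' = d \<longleftrightarrow> y = d" if "d \<in> D" for d
      proof -
        have "graph_dist G (Inl d) (Inl y') = graph_dist G (Inl d) (Inl y)"
          using same that Inl \<open>u = Inl y\<close> by auto
        then show ?thesis
          using y y' that assms(1,5) by (auto simp: dist_point_point subset_iff split: if_splits)
      qed
      moreover have "y' \<in> n \<longleftrightarrow> y \<in> n" if "n \<in> N" for n
      proof -
        have "graph_dist G (Inr n) (Inl y') = graph_dist G (Inr n) (Inl y)"
          using same that Inl \<open>u = Inl y\<close> by auto
        then show ?thesis
          using y y' that assms(2,5) by (auto simp: dist_incidence subset_iff split: if_splits)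
      qed
      ultimately have "y' \<in> R" using y' by (intro subsetD[OF R(1)]) simp
      then show ?thesis using Inl by simp
    next
      case (Inr m')
      then have m': "m' \<in> L" using that by auto
      \<comment> \<open>Any single probe separates the two sides: one side is seen at distance 1 or
        3, the other at an even distance.\<close>
      have "\<not> ?same u'"
      proof (cases "D = {}")
        case True
        then obtain n where "n \<in> N" using assms(3) by blast
        moreover from this have "graph_dist G (Inr n) u' \<noteq> graph_dist G (Inr n) u"
          using Inr \<open>u = Inl y\<close> y m' assms(2,5,6)
          by (auto simp: dist_incidence dist_block_block subset_iff split: if_splits)
        ultimately show ?thesis by blast
      next
        case False
        then obtain d where "d \<in> D" by blast
        moreover from this have "graph_dist G (Inl d) u' \<noteq> graph_dist G (Inl d) u"
          using Inr \<open>u = Inl y\<close> y m' assms(1,5,6)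
          by (auto simp: dist_incidence dist_point_point subset_iff split: if_splits)
        ultimately show ?thesis by blast
      qed
      then show ?thesis using same by blast
    qed
    then have "{u' \<in> Inl ` S \<union> Inr ` L. ?same u'} \<subseteq> Inl ` R" by blast
    moreover have "Inl ` R = {u} \<or> cops_win G (k + 1) (closed_nbhd G (Inl ` R))"
      using R(2) Inl by auto
    ultimately show ?thesis by blast
  next
    case (Inr m)
    then have m: "m \<in> L" using u by auto
    obtain R where R: "{m' \<in> L. (\<forall>d\<in>D. d \<in> m' \<longleftrightarrow> d \<in> m) \<and>
        (\<forall>n\<in>N. (m' = n \<longleftrightarrow> m = n) \<and> (parallel n m' \<longleftrightarrow> parallel n m))} \<subseteq> R"
      "R = {m} \<or> cops_win G (k + 1) (closed_nbhd G (Inr ` R))"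
      using blocks[OF m] by blast
    have "u' \<in> Inr ` R" if "u' \<in> Inl ` S \<union> Inr ` L" and same: "?same u'" for u'
    proof (cases u')
      case (Inr m')
      then have m': "m' \<in> L" using that by auto
      have "d \<in> m' \<longleftrightarrow> d \<in> m" if "d \<in> D" for d
      proof -
        have "graph_dist G (Inl d) (Inr m') = graph_dist G (Inl d) (Inr m)"
          using same that Inr \<open>u = Inr m\<close> by auto
        then show ?thesis
          using m m' that assms(1,6) by (auto simp: dist_incidence subset_iff split: if_splits)
      qed
      moreover have "(m' = n \<longleftrightarrow> m = n) \<and> (parallel n m' \<longleftrightarrow> parallel n m)" if "n \<in> N" for n
      proof -
        have "graph_dist G (Inr n) (Inr m') = graph_dist G (Inr n) (Inr m)"
          using same that Inr \<open>u = Inr m\<close> by auto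
        then show ?thesis
          using m m' that assms(2,6) by (auto simp: dist_block_block subset_iff split: if_splits)
      qed
      ultimately have "m' \<in> R" using m' by (intro subsetD[OF R(1)]) simp
      then show ?thesis using Inr by simp
    next
      case (Inl y')
      then have y': "y' \<in> S" using that by auto
      have "\<not> ?same u'"
      proof (cases "D = {}")
        case True
        then obtain n where "n \<in> N" using assms(3) by blast
        moreover from this have "graph_dist G (Inr n) u' \<noteq> graph_dist G (Inr n) u"
          using Inl \<open>u = Inr m\<close> m y' assms(2,5,6)
          by (auto simp: dist_incidence dist_block_block subset_iff split: if_splits)
        ultimately show ?thesis by blast
      next
        case False
        then obtain d where "d \<in> D" by blast
        moreover from this have "graph_dist G (Inl d) u' \<noteq> graph_dist G (Inl d) u"
          using Inl \<open>u = Inr m\<close> m y' assms(1,5,6)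
          by (auto simp: dist_incidence dist_point_point subset_iff split: if_splits)
        ultimately show ?thesis by blast
      qed
      then show ?thesis using same by blast
    qed
    then have "{u' \<in> Inl ` S \<union> Inr ` L. ?same u'} \<subseteq> Inr ` R" by blast
    moreover have "Inr ` R = {u} \<or> cops_win G (k + 1) (closed_nbhd G (Inr ` R))"
      using R(2) Inr by auto
    ultimately show ?thesis by blast
  qed
qed

text \<open>\<open>S\<close> is what the cops know just before the robber moves; their next probe
  faces its closed neighbourhood.\<close>

definition wins_points :: "'a set \<Rightarrow> bool" where
  "wins_points S \<longleftrightarrow> cops_win G (k + 1) (closed_nbhd G (Inl ` S))"

definition wins_blocks :: "'a set set \<Rightarrow> bool" where
  "wins_blocks L \<longleftrightarrow> cops_win G (k + 1) (closed_nbhd G (Inr ` L))"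

lemma closed_nbhd_points:
  "S \<subseteq> X \<Longrightarrow> closed_nbhd G (Inl ` S) = Inl ` S \<union> Inr ` {m \<in> \<B>. m \<inter> S \<noteq> {}}"
  by (auto simp: closed_nbhd_def incidence_graph_def)

lemma closed_nbhd_blocks:
  assumes "L \<subseteq> \<B>"
  shows "closed_nbhd G (Inr ` L) = Inl ` \<Union>L \<union> Inr ` L"
proof -
  have "(\<exists>r\<in>Inr ` L. (r, Inl x) \<in> parcs G) \<longleftrightarrow> x \<in> \<Union>L" for x
    using assms block_subset by (simp add: subset_iff) blast
  moreover have "\<not> (\<exists>r\<in>Inr ` L. (r, Inr m) \<in> parcs G)" for m by simp
  ultimately have "{u. \<exists>r\<in>Inr ` L. (r, u) \<in> parcs G} = Inl ` \<Union>L"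
    by (intro set_eqI) (case_tac x; auto)
  then show ?thesis by (auto simp: closed_nbhd_def)
qed

text \<open>Probing all candidate points tells which of them the robber's new block contains; the
  remaining cops test its direction.\<close>

lemma wins_points_step:
  assumes l: "l \<in> \<B>" "S \<subseteq> l" and S: "2 \<le> card S" "card S \<le> k - 1"
    and next_wins: "\<And>z T. z \<in> X \<Longrightarrow> T \<subseteq> pencil z \<Longrightarrow> 2 \<le> card T \<Longrightarrow> card T < card S \<Longrightarrow>
      wins_blocks T"
  shows "wins_points S"
proof -
  have SX: "S \<subseteq> X" using l block_subset by blast
  obtain q where q: "q \<in> S" using S(1) by fastforce
  have qX: "q \<in> X" and lq: "l \<in> pencil q" using q SX l by (auto simp: pencil_def)
  have "card (pencil q - {l}) = k"
    using card_pencil[OF qX] lq finite_pencil by (simp add: pencil_def)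
  \<comment> \<open>Lines through \<open>q\<close> have pairwise different directions. The direction
    of \<open>l\<close> is left out: a line other than \<open>l\<close> through a point of
    \<open>S\<close> is never parallel to \<open>l\<close>.\<close>
  then have "k + 1 - card S \<le> card (pencil q - {l})" using S(1) by simp
  then obtain N where N: "N \<subseteq> pencil q - {l}" "card N = k + 1 - card S"
    by (rule obtain_subset_with_card_n)
  have "cops_win G (k + 1) (Inl ` S \<union> Inr ` {m \<in> \<B>. m \<inter> S \<noteq> {}})"
  proof (rule cops_win_probe[of S N])
    show "N \<subseteq> \<B>" using N(1) by (auto simp: pencil_def)
    show "card S + card N \<le> k + 1" using N(2) S by simp
    show "S \<noteq> {} \<or> N \<noteq> {}" using q by blast
  next
    fix y assume "y \<in> S"
    then show "\<exists>R. {y' \<in> S. (\<forall>d\<in>S. y' = d \<longleftrightarrow> y = d) \<and> (\<forall>n\<in>N. y' \<in> n \<longleftrightarrow> y \<in> n)} \<subseteq> R \<and>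
      (R = {y} \<or> cops_win G (k + 1) (closed_nbhd G (Inl ` R)))"
      by (intro exI[of _ "{y}"]) auto
  next
    fix m assume "m \<in> {m \<in> \<B>. m \<inter> S \<noteq> {}}"
    then obtain z where m: "m \<in> \<B>" "z \<in> m" "z \<in> S" by blast
    let ?Q = "{m' \<in> {m \<in> \<B>. m \<inter> S \<noteq> {}}. (\<forall>d\<in>S. d \<in> m' \<longleftrightarrow> d \<in> m) \<and>
        (\<forall>n\<in>N. (m' = n \<longleftrightarrow> m = n) \<and> (parallel n m' \<longleftrightarrow> parallel n m))}"
    have "\<not> S \<subseteq> {z}" using S(1) card_mono[of "{z}" S] by auto
    then obtain z' where z': "z' \<in> S" "z' \<noteq> z" by blast
    have zX: "z \<in> X" using m SX by blast
    have "\<exists>R. ?Q \<subseteq> R \<and> (R = {m} \<or> wins_blocks R)"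
    proof (cases "m = l")
      case True
      have "m' = m" if "m' \<in> ?Q" for m'
      proof -
        have "z \<in> m'" "z' \<in> m'" "m' \<in> \<B>" using that m z' True l(2) by auto
        then show ?thesis using join_unique[of m' m z z'] m z' True l by auto
      qed
      then show ?thesis by blast
    next
      case False
      \<comment> \<open>Only \<open>l\<close> contains both \<open>z\<close> and \<open>z'\<close>,
        so the answers for these two points tell \<open>l\<close> from the other lines through
        \<open>z\<close>.\<close>
      have "z' \<notin> m" using join_unique[of m l z z'] m z' False l by blast
      then have Q: "m' \<in> pencil z" "m' \<noteq> l" if "m' \<in> ?Q" for m'
        using that m z' l(2) by (auto simp: pencil_def)
      show ?thesis
      proof (cases "\<exists>n\<in>N. parallel n m")
        case True
        then obtain n where n: "n \<in> N" "parallel n m" by blast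
        have "n \<in> \<B>" using n N(1) by (auto simp: pencil_def)
        have "m' = m" if "m' \<in> ?Q" for m'
        proof -
          have "parallel n m'" using that n by blast
          then show ?thesis
            using ex1_parallel[OF \<open>n \<in> \<B>\<close> zX] Q(1)[OF that] n m by (auto simp: pencil_def)
        qed
        then show ?thesis by blast
      next
        case no_par: False
        \<comment> \<open>The lines through \<open>z\<close> in an untested direction other than
          that of \<open>l\<close>. Of the \<open>k + 1\<close> lines, \<open>k + 2 - card S\<close>
          are removed, which leaves \<open>card S - 1\<close>.\<close>
        define T where "T = pencil z - {m \<in> pencil z. \<exists>n\<in>insert l N. parallel n m}"
        have "card {m \<in> pencil z. \<exists>n\<in>insert l N. parallel n m} = card (insert l N)"
          by (rule card_pencil_parallel[OF qX zX]) (use N(1) lq in blast)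
        also have "\<dots> = k + 2 - card S"
        proof -
          have "l \<notin> N" "finite N" using N(1) finite_subset[OF N(1)] finite_pencil by auto
          then show ?thesis using N(2) S by simp
        qed
        finally have cardT: "card T = card S - 1"
          using card_pencil[OF zX] S
          by (simp add: T_def card_Diff_subset finite_pencil pencil_def[symmetric])
        have notpar: "\<not> parallel l m'" if "m' \<in> pencil z" "m' \<noteq> l" for m'
          using that parallel_eqI[of l m' z] m l by (auto simp: pencil_def)
        have "?Q \<subseteq> T"
        proof
          fix m' assume m': "m' \<in> ?Q"
          then have "\<forall>n\<in>N. \<not> parallel n m'" using no_par by blast
          then show "m' \<in> T" using Q[OF m'] notpar by (auto simp: T_def)
        qed
        moreover have "T = {m} \<or> wins_blocks T"
        proof (cases "2 \<le> card T")
          case True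
          then show ?thesis using next_wins[OF zX, of T] cardT S by (auto simp: T_def)
        next
          case False
          then have "card T = 1" using cardT S by simp
          moreover have "m \<in> T" using m notpar no_par \<open>m \<noteq> l\<close> by (auto simp: T_def pencil_def)
          ultimately show ?thesis by (auto simp: card_1_singleton_iff)
        qed
        ultimately show ?thesis by blast
      qed
    qed
    then show "\<exists>R. ?Q \<subseteq> R \<and> (R = {m} \<or> cops_win G (k + 1) (closed_nbhd G (Inr ` R)))"
      unfolding wins_blocks_def .
  qed (use SX in auto)
  then show ?thesis using SX by (simp add: wins_points_def closed_nbhd_points)
qed

text \<open>Probing all candidate blocks tells on which of them the robber's new point lies; the
  remaining cops cut that block with lines of a transversal parallel class.\<close>

lemma wins_blocks_step:
  assumes z: "z \<in> X" and T: "T \<subseteq> pencil z" "2 \<le> card T" "card T \<le> k - 2"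
    and next_wins: "\<And>l S. l \<in> \<B> \<Longrightarrow> S \<subseteq> l \<Longrightarrow> 2 \<le> card S \<Longrightarrow> card S < card T \<Longrightarrow> wins_points S"
  shows "wins_blocks T"
proof -
  have TB: "T \<subseteq> \<B>" using T by (auto simp: pencil_def)
  have finT: "finite T" using TB finite_blocks finite_subset by blast
  \<comment> \<open>A line \<open>n0\<close> through \<open>z\<close> outside \<open>T\<close>
    provides the transversal class: a line of \<open>T\<close> parallel to \<open>n0\<close> would
    equal it, as both contain \<open>z\<close>.\<close>
  have "\<not> pencil z \<subseteq> T"
    using card_mono[OF finT, of "pencil z"] card_pencil[OF z] T by (auto simp: pencil_def)
  then obtain n0 where n0: "n0 \<in> \<B>" "z \<in> n0" "n0 \<notin> T" by (auto simp: pencil_def)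
  have "card (parallel_class n0 - {n0}) = k - 1"
    using card_parallel_class[OF n0(1)] n0(1) finite_parallel_class
    by (simp add: parallel_class_def)
  then have "k + 1 - card T \<le> card (parallel_class n0 - {n0})" using T(2) by simp
  then obtain N where N: "N \<subseteq> parallel_class n0 - {n0}" "card N = k + 1 - card T"
    by (rule obtain_subset_with_card_n)
  have NB: "N \<subseteq> \<B>" using N(1) by (auto simp: parallel_class_def)
  have par: "parallel n n'" if "n \<in> insert n0 N" "n' \<in> insert n0 N" for n n'
    using that N(1) parallel_trans[of n n0 n'] parallel_sym n0(1) NB by (auto simp: parallel_class_def)
  have trans: "\<not> parallel m n" if "m \<in> T" "n \<in> insert n0 N" for m n
  proof
    assume "parallel m n"
    then have "parallel m n0"
      using parallel_trans[of m n n0] par[of n n0] that TB NB n0(1) by auto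
    then show False using parallel_eqI[of m n0 z] that T n0 by (auto simp: pencil_def)
  qed
  have "cops_win G (k + 1) (Inl ` \<Union>T \<union> Inr ` T)"
  proof (rule cops_win_probe[of "{}" "T \<union> N"])
    show "T \<union> N \<subseteq> \<B>" using TB NB by blast
    show "{} \<noteq> {} \<or> T \<union> N \<noteq> {}" using T by force
    have "card (T \<union> N) \<le> card T + card N" by (rule card_Un_le)
    then show "card {} + card (T \<union> N) \<le> k + 1" using N(2) T by simp
    show "\<Union>T \<subseteq> X" using TB block_subset by blast
  next
    fix m assume "m \<in> T"
    then show "\<exists>R. {m' \<in> T. (\<forall>d\<in>{}. d \<in> m' \<longleftrightarrow> d \<in> m) \<and>
        (\<forall>n\<in>T \<union> N. (m' = n \<longleftrightarrow> m = n) \<and> (parallel n m' \<longleftrightarrow> parallel n m))} \<subseteq> R \<and>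
      (R = {m} \<or> cops_win G (k + 1) (closed_nbhd G (Inr ` R)))"
      by (intro exI[of _ "{m}"]) auto
  next
    fix y assume "y \<in> \<Union>T"
    then obtain m where m: "m \<in> T" "y \<in> m" by blast
    then have mB: "m \<in> \<B>" and zm: "z \<in> m" using T by (auto simp: pencil_def)
    \<comment> \<open>A second probed line \<open>m2\<close> through \<open>z\<close> tells
      \<open>z\<close>, its only common point with \<open>m\<close>, from the other points of
      \<open>m\<close>.\<close>
    have "\<not> T \<subseteq> {m}" using T(2) card_mono[of "{m}" T] by auto
    then obtain m2 where m2: "m2 \<in> T" "m2 \<noteq> m" by blast
    then have m2B: "m2 \<in> \<B>" "z \<in> m2" using T by (auto simp: pencil_def)
    let ?Q = "{y' \<in> \<Union>T. (\<forall>d\<in>{}. y' = d \<longleftrightarrow> y = d) \<and> (\<forall>n\<in>T \<union> N. y' \<in> n \<longleftrightarrow> y \<in> n)}"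
    have Q: "y' \<in> m" if "y' \<in> ?Q" for y' using that m by blast
    have "\<exists>R. ?Q \<subseteq> R \<and> (R = {y} \<or> wins_points R)"
    proof (cases "y \<in> m2")
      case True
      have "y' = y" if "y' \<in> ?Q" for y'
      proof -
        have "y' \<in> m2" using that True m2 by blast
        then show ?thesis using join_unique[of m m2 y y'] m m2 True mB m2B Q[OF that] by blast
      qed
      then show ?thesis by blast
    next
      case False
      then have Qz: "y' \<noteq> z" if "y' \<in> ?Q" for y' using that m2 m2B by blast
      show ?thesis
      proof (cases "\<exists>n\<in>N. y \<in> n")
        case True
        then obtain n where n: "n \<in> N" "y \<in> n" by blast
        have "y' = y" if "y' \<in> ?Q" for y'
        proof -
          have "y' \<in> n" using that n by blast
          then show ?thesis using meet_unique[of m n y' y] trans[of m n] Q[OF that] m n mB NB by blast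
        qed
        then show ?thesis by blast
      next
        case no_cut: False
        \<comment> \<open>Adding \<open>n0\<close> to \<open>N\<close> removes precisely the point
          \<open>z\<close> from \<open>m\<close>. So \<open>k + 2 - card T\<close> points are cut
          off and \<open>card T - 2\<close> are left.\<close>
        define S where "S = m - \<Union>(insert n0 N)"
        have "card S = k - card (insert n0 N)"
          unfolding S_def
          by (rule card_line_minus_class) (use mB n0(1) NB trans m(1) par in auto)
        moreover have "finite N" "n0 \<notin> N" using N(1) NB finite_blocks finite_subset by auto
        ultimately have cardS: "card S = card T - 2" using N(2) T by simp
        have off: "y' \<notin> n0" if "y' \<in> m" "y' \<noteq> z" for y'
          using meet_unique[of m n0 y' z] trans[of m n0] that m n0 mB zm by blast
        have "?Q \<subseteq> S"
        proof
          fix y' assume y': "y' \<in> ?Q"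
          then have "\<forall>n\<in>N. y' \<notin> n" using no_cut by blast
          then show "y' \<in> S" using Q[OF y'] Qz[OF y'] off by (auto simp: S_def)
        qed
        moreover have "S = {y} \<or> wins_points S"
        proof (cases "2 \<le> card S")
          case True
          then show ?thesis using next_wins[OF mB, of S] cardS T by (auto simp: S_def)
        next
          case False
          have "y \<in> ?Q" using m by blast
          then have "y \<in> S" using \<open>?Q \<subseteq> S\<close> by blast
          moreover have "finite S" using finite_block[OF mB] by (simp add: S_def)
          ultimately have "card S = 1" using False by (cases "card S") auto
          then show ?thesis using \<open>y \<in> S\<close> by (auto simp: card_1_singleton_iff)
        qed
        ultimately show ?thesis by blast
      qed
    qed
    then show "\<exists>R. ?Q \<subseteq> R \<and> (R = {y} \<or> cops_win G (k + 1) (closed_nbhd G (Inl ` R)))"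
      unfolding wins_points_def .
  qed (use TB in auto)
  then show ?thesis using TB by (simp add: wins_blocks_def closed_nbhd_blocks)
qed

text \<open>Strong induction on the number of candidates, points and lines calling on each other.
  The bounds fit: at most \<open>k - 1\<close> points lead to strictly fewer lines, hence at most
  \<open>k - 2\<close>. For \<open>n = 2\<close> the premise on smaller sets is vacuous, which
  starts the induction.\<close>

lemma wins_points_and_blocks:
  "(\<forall>l S. l \<in> \<B> \<and> S \<subseteq> l \<and> card S = n \<and> 2 \<le> n \<and> n \<le> k - 1 \<longrightarrow> wins_points S) \<and>
   (\<forall>z T. z \<in> X \<and> T \<subseteq> pencil z \<and> card T = n \<and> 2 \<le> n \<and> n \<le> k - 2 \<longrightarrow> wins_blocks T)"
proof (induction n rule: less_induct)
  case (less n)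
  have "wins_points S" if S: "l \<in> \<B>" "S \<subseteq> l" "card S = n" "2 \<le> n" "n \<le> k - 1" for l S
  proof (rule wins_points_step[OF S(1,2)])
    fix z T assume T: "z \<in> X" "T \<subseteq> pencil z" "2 \<le> card T" "card T < card S"
    then have "card T < n" "card T \<le> k - 2" using S(3,5) by simp_all
    then show "wins_blocks T" using less[of "card T"] T by blast
  qed (use S in auto)
  moreover have "wins_blocks T"
    if T: "z \<in> X" "T \<subseteq> pencil z" "card T = n" "2 \<le> n" "n \<le> k - 2" for z T
  proof (rule wins_blocks_step[OF T(1,2)])
    fix l S assume S: "l \<in> \<B>" "S \<subseteq> l" "2 \<le> card S" "card S < card T"
    then have "card S < n" "card S \<le> k - 1" using T(3,5) by simp_all
    then show "wins_points S" using less[of "card S"] S by blast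
  qed (use T in auto)
  ultimately show ?case by blast
qed

text \<open>The descent in the form that \<open>cops_win_probe\<close> asks for, where a single
  candidate counts as caught.\<close>

lemma wins_collinear_points:
  assumes "l \<in> \<B>" "S \<subseteq> l" "card S \<le> k - 1" "y \<in> S"
  shows "S = {y} \<or> wins_points S"
proof (cases "2 \<le> card S")
  case True
  then show ?thesis using wins_points_and_blocks assms by blast
next
  case False
  have "finite S" using assms finite_block finite_subset by blast
  then have "card S = 1" using False assms(4) by (cases "card S") auto
  then show ?thesis using assms(4) by (auto simp: card_1_singleton_iff)
qed

text \<open>Probing these \<open>k - 1\<close> lines identifies a robber that stays on its line and
  otherwise names the line containing its point. The two remaining cops take two lines of a
  transversal class; these cut off two points and leave at most \<open>k - 2\<close> collinear
  candidates.\<close>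

lemma wins_parallel_class:
  assumes l: "l \<in> \<B>"
  shows "wins_blocks (parallel_class l - {l})"
proof -
  define L where "L = parallel_class l - {l}"
  have LB: "L \<subseteq> \<B>" by (auto simp: L_def parallel_class_def)
  have cardL: "card L = k - 1"
    using card_parallel_class[OF l] l finite_parallel_class
    by (simp add: L_def parallel_class_def)
  obtain n0 where n0: "n0 \<in> \<B>" "\<not> parallel l n0" using ex_nonparallel[OF l] by blast
  obtain N where N: "N \<subseteq> parallel_class n0" "card N = 2"
    using obtain_subset_with_card_n[of 2 "parallel_class n0"] card_parallel_class[OF n0(1)] k_ge
    by auto
  have NB: "N \<subseteq> \<B>" using N(1) by (auto simp: parallel_class_def)
  have par: "parallel n n'" if "n \<in> N" "n' \<in> N" for n n'
    using that N(1) parallel_trans[of n n0 n'] parallel_sym n0(1) NB by (auto simp: parallel_class_def)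
  have trans: "\<not> parallel m n" if "m \<in> L" "n \<in> N" for m n
  proof
    assume "parallel m n"
    moreover have "m \<in> \<B>" "n \<in> \<B>" "parallel l m" "parallel n n0"
      using that N(1) parallel_sym by (auto simp: L_def parallel_class_def)
    ultimately show False using parallel_trans l n0 by meson
  qed
  have "cops_win G (k + 1) (Inl ` \<Union>L \<union> Inr ` L)"
  proof (rule cops_win_probe[of "{}" "L \<union> N"])
    show "L \<union> N \<subseteq> \<B>" using LB NB by blast
    show "{} \<noteq> {} \<or> L \<union> N \<noteq> {}" using N(2) by force
    have "card (L \<union> N) \<le> card L + card N" by (rule card_Un_le)
    then show "card {} + card (L \<union> N) \<le> k + 1" using N(2) cardL k_ge by simp
    show "\<Union>L \<subseteq> X" using LB block_subset by blast
  next
    fix m assume "m \<in> L"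
    then show "\<exists>R. {m' \<in> L. (\<forall>d\<in>{}. d \<in> m' \<longleftrightarrow> d \<in> m) \<and>
        (\<forall>n\<in>L \<union> N. (m' = n \<longleftrightarrow> m = n) \<and> (parallel n m' \<longleftrightarrow> parallel n m))} \<subseteq> R \<and>
      (R = {m} \<or> cops_win G (k + 1) (closed_nbhd G (Inr ` R)))"
      by (intro exI[of _ "{m}"]) auto
  next
    fix y assume "y \<in> \<Union>L"
    then obtain m where m: "m \<in> L" "y \<in> m" by blast
    then have mB: "m \<in> \<B>" using LB by blast
    let ?Q = "{y' \<in> \<Union>L. (\<forall>d\<in>{}. y' = d \<longleftrightarrow> y = d) \<and> (\<forall>n\<in>L \<union> N. y' \<in> n \<longleftrightarrow> y \<in> n)}"
    have Q: "y' \<in> m" if "y' \<in> ?Q" for y' using that m by blast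
    have "\<exists>R. ?Q \<subseteq> R \<and> (R = {y} \<or> wins_points R)"
    proof (cases "\<exists>n\<in>N. y \<in> n")
      case True
      then obtain n where n: "n \<in> N" "y \<in> n" by blast
      have "y' = y" if "y' \<in> ?Q" for y'
      proof -
        have "y' \<in> n" using that n by blast
        then show ?thesis using meet_unique[of m n y' y] trans[of m n] Q[OF that] m n mB NB by blast
      qed
      then show ?thesis by blast
    next
      case no_cut: False
      have "card (m - \<Union>N) = k - card N"
        by (rule card_line_minus_class) (use mB NB trans m(1) par in auto)
      then have "m - \<Union>N = {y} \<or> wins_points (m - \<Union>N)"
        using wins_collinear_points[OF mB, of "m - \<Union>N" y] N(2) m no_cut by auto
      moreover have "?Q \<subseteq> m - \<Union>N" using Q no_cut by blast
      ultimately show ?thesis by blast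
    qed
    then show "\<exists>R. ?Q \<subseteq> R \<and> (R = {y} \<or> cops_win G (k + 1) (closed_nbhd G (Inl ` R)))"
      unfolding wins_points_def .
  qed (use LB in auto)
  then show ?thesis using LB by (simp add: wins_blocks_def closed_nbhd_blocks L_def)
qed

text \<open>A point other than \<open>q\<close> lies on exactly one line through \<open>q\<close>,
  and a block missing \<open>q\<close> is parallel to exactly one. So the answers of
  \<open>pencil q\<close> single out a line without \<open>q\<close>, or a parallel class without
  its line through \<open>q\<close>, unless they locate the robber outright.\<close>

lemma wins_from_start:
  assumes q: "q \<in> X"
  shows "cops_win G (k + 1) (pverts G)"
proof -
  have two: "\<exists>m2\<in>pencil q. m2 \<noteq> m" for m
  proof -
    have "\<not> pencil q \<subseteq> {m}"
      using card_mono[of "{m}" "pencil q"] card_pencil[OF q] k_ge by (auto simp: pencil_def)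
    then show ?thesis by blast
  qed
  have "cops_win G (k + 1) (Inl ` X \<union> Inr ` \<B>)"
  proof (rule cops_win_probe[of "{}" "pencil q"])
    show "pencil q \<subseteq> \<B>" by (auto simp: pencil_def)
    show "{} \<noteq> {} \<or> pencil q \<noteq> {}" using two by blast
    show "card {} + card (pencil q) \<le> k + 1" using card_pencil[OF q] by (simp add: pencil_def)
  next
    fix y assume y: "y \<in> X"
    let ?Q = "{y' \<in> X. (\<forall>d\<in>{}. y' = d \<longleftrightarrow> y = d) \<and> (\<forall>n\<in>pencil q. y' \<in> n \<longleftrightarrow> y \<in> n)}"
    obtain l where l: "l \<in> \<B>" "q \<in> l" "y \<in> l" using ex_join q y by blast
    then have lq: "l \<in> pencil q" by (simp add: pencil_def)
    \<comment> \<open>A second line through \<open>q\<close> distinguishes \<open>q\<close> from the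
      other points of \<open>l\<close>.\<close>
    obtain l2 where l2: "l2 \<in> pencil q" "l2 \<noteq> l" using two by blast
    then have l2B: "l2 \<in> \<B>" "q \<in> l2" by (auto simp: pencil_def)
    have meet: "y' = q" if "y' \<in> l" "y' \<in> l2" for y'
      using join_unique[of l l2 q y'] that l l2 l2B by blast
    have "\<exists>R. ?Q \<subseteq> R \<and> (R = {y} \<or> wins_points R)"
    proof (cases "y = q")
      case True
      have "?Q \<subseteq> {y}"
      proof
        fix y' assume "y' \<in> ?Q"
        then have "y' \<in> l" "y' \<in> l2" using True l l2 l2B lq by auto
        then show "y' \<in> {y}" using meet True by blast
      qed
      then show ?thesis by blast
    next
      case False
      then have "y \<notin> l2" using meet l by blast
      have "?Q \<subseteq> l - {q}"
      proof
        fix y' assume y': "y' \<in> ?Q"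
        then have "y' \<in> l" using lq l by blast
        moreover have "y' \<noteq> q" using y' l2(1) l2B \<open>y \<notin> l2\<close> by blast
        ultimately show "y' \<in> l - {q}" by blast
      qed
      moreover have "l - {q} = {y} \<or> wins_points (l - {q})"
        using wins_collinear_points[OF l(1), of "l - {q}" y] l False card_block finite_block by auto
      ultimately show ?thesis by blast
    qed
    then show "\<exists>R. ?Q \<subseteq> R \<and> (R = {y} \<or> cops_win G (k + 1) (closed_nbhd G (Inl ` R)))"
      unfolding wins_points_def .
  next
    fix m assume m: "m \<in> \<B>"
    let ?Q = "{m' \<in> \<B>. (\<forall>d\<in>{}. d \<in> m' \<longleftrightarrow> d \<in> m) \<and>
        (\<forall>n\<in>pencil q. (m' = n \<longleftrightarrow> m = n) \<and> (parallel n m' \<longleftrightarrow> parallel n m))}"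
    have "\<exists>R. ?Q \<subseteq> R \<and> (R = {m} \<or> wins_blocks R)"
    proof (cases "q \<in> m")
      case True
      then have "m \<in> pencil q" using m by (simp add: pencil_def)
      then have "?Q \<subseteq> {m}" by blast
      then show ?thesis by blast
    next
      case False
      obtain l where l: "l \<in> \<B>" "q \<in> l" "parallel m l" using ex1_parallel[OF m q] by blast
      then have "l \<in> pencil q" "m \<noteq> l" "parallel l m"
        using False parallel_sym by (auto simp: pencil_def)
      then have "?Q \<subseteq> parallel_class l - {l}" by (auto simp: parallel_class_def)
      then show ?thesis using wins_parallel_class[OF l(1)] by blast
    qed
    then show "\<exists>R. ?Q \<subseteq> R \<and> (R = {m} \<or> cops_win G (k + 1) (closed_nbhd G (Inr ` R)))"
      unfolding wins_blocks_def .
  qed auto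
  then show ?thesis by (simp add: incidence_graph_def)
qed

end

theorem theorem3p3:
  fixes X :: "'a set" and \<B> :: "'a set set" and v b r k :: nat
  assumes "bibd X \<B> v b r k 1" and "r = k + 1" and "k \<ge> 3"
  shows "localization_number (incidence_graph X \<B>) \<le> enat (k + 1)"
proof (cases "X = {}")
  case True
  let ?G = "incidence_graph X \<B>"
  have "card B = k" "B = {}" if "B \<in> \<B>" for B
    using assms(1) True that by (auto simp: bibd_def)
  then have "\<B> = {}" using assms(3) by fastforce
  then have "pverts ?G = {}" using True by (simp add: incidence_graph_def)
  \<comment> \<open>Without vertices a legal strategy can only probe the empty list, so zero cops
    are used; they win vacuously because no robber walk exists.\<close>
  then have "winning_strategy ?G 0 (\<lambda>_. [])"
    by (simp add: winning_strategy_def robber_walk_def)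
  then have "localization_number ?G \<le> enat 0"
    unfolding localization_number_def by (intro INF_lower) auto
  then show ?thesis by (rule order_trans) simp
next
  case False
  then obtain q where q: "q \<in> X" by blast
  interpret affine_plane X \<B> k
    by unfold_locales (use assms in \<open>auto simp: bibd_def\<close>)
  show ?thesis by (rule localization_number_le[OF wins_from_start[OF q]])
qed

end
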